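(* For every odd integer $\Delta\ge 3$, there exists a vertex-weighted graph $G=(V,E,w)$ with nonnegative vertex weights and maximum degree $\Delta$ such that, for any integer $k<\frac{3\Delta}{2}$ and any $\alpha<\sqrt{2}$, no $\alpha$-EQ1 $k$-coloring of $G$ exists.
   Context: For $S\subseteq V$, $w(S)=\sum_{v\in S}w_v$. A $k$-coloring of $G$ is a partition $(C_1,\dots,C_k)$ of $V$ into $k$ (possibly empty) sets, each of which is an independent set of $G$. For $\alpha\ge 1$, a coloring $(C_1,\dots,C_k)$ is $\alpha$-EQ1 if for every $i,j\in[k]$ with $C_i\neq\emptyset$ there exists a vertex $\bar v\in C_i$ such that $w(C_i\setminus\{\bar v\})\le \alpha\, w(C_j)$. *)

theory Defs
  imports Complex_Main "HOL-Library.Disjoint_Sets"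
begin

definition weighted_graph :: "'a set \<Rightarrow> 'a set set \<Rightarrow> ('a \<Rightarrow> real) \<Rightarrow> bool" where
  "weighted_graph V E w \<longleftrightarrow>
     finite V \<and> (\<forall>e\<in>E. e \<subseteq> V \<and> card e = 2) \<and> (\<forall>v\<in>V. 0 \<le> w v)"

definition degree :: "'a set set \<Rightarrow> 'a \<Rightarrow> nat" where
  "degree E v = card {e \<in> E. v \<in> e}"

(* The inserted 0 only matters for the graph without vertices. *)
definition max_degree :: "'a set \<Rightarrow> 'a set set \<Rightarrow> nat" where
  "max_degree V E = Max (insert 0 (degree E ` V))"

definition independent_set :: "'a set \<Rightarrow> 'a set set \<Rightarrow> 'a set \<Rightarrow> bool" where
  "independent_set V E S \<longleftrightarrow> S \<subseteq> V \<and> (\<forall>u\<in>S. \<forall>v\<in>S. {u, v} \<notin> E)"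

(* Color classes are indexed by 1, ..., k and may be empty; values of C outside
   this range are irrelevant. *)
definition coloring :: "'a set \<Rightarrow> 'a set set \<Rightarrow> nat \<Rightarrow> (nat \<Rightarrow> 'a set) \<Rightarrow> bool" where
  "coloring V E k C \<longleftrightarrow>
     (\<Union>i\<in>{1..k}. C i) = V \<and>
     disjoint_family_on C {1..k} \<and>
     (\<forall>i\<in>{1..k}. independent_set V E (C i))"

definition EQ1 :: "real \<Rightarrow> ('a \<Rightarrow> real) \<Rightarrow> nat \<Rightarrow> (nat \<Rightarrow> 'a set) \<Rightarrow> bool" where
  "EQ1 \<alpha> w k C \<longleftrightarrow>
     (\<forall>i\<in>{1..k}. \<forall>j\<in>{1..k}. C i \<noteq> {} \<longrightarrow>
        (\<exists>v\<in>C i. sum w (C i - {v}) \<le> \<alpha> * sum w (C j)))"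

end

theory Submission
  imports Defs
begin

text \<open>
  Write \<open>\<Delta> = 2m + 1\<close>. The witness is the disjoint union of \<open>K\<^bsub>\<Delta>,\<Delta>\<^esub>\<close>, with weight \<open>\<surd>2\<close> on one side \<open>A\<close>
  and weight \<open>1\<close> on the other side \<open>B\<close>, and of a clique \<open>K\<^bsub>\<Delta>+1\<^esub>\<close> of weight \<open>0\<close>, which forces
  \<open>k \<ge> 2m + 2\<close>. The classes meeting \<open>A\<close> are disjoint from those meeting \<open>B\<close>, and \<open>k \<le> 3m + 1\<close>.

  If at most \<open>m\<close> classes meet \<open>B\<close>, one of them has three vertices of \<open>B\<close>, so every class weighs at
  least \<open>2/\<alpha> > \<surd>2\<close> and hence has two vertices of positive weight; but there are only \<open>4m + 2 < 2k\<close>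
  such vertices. Otherwise at most \<open>2m\<close> classes meet \<open>A\<close>, one of them has two vertices of \<open>A\<close>, so
  every class weighs at least \<open>\<surd>2/\<alpha> > 1\<close>; then the at least \<open>m + 1\<close> classes meeting \<open>B\<close> have two
  vertices of \<open>B\<close> each, which exceeds \<open>2m + 1\<close>.
\<close>

lemma sum_card_color_classes:
  assumes "coloring V E k C" "finite V" "X \<subseteq> V"
  shows "(\<Sum>i\<in>{1..k}. card (C i \<inter> X)) = card X"
proof -
  have U: "(\<Union>i\<in>{1..k}. C i) = V" and D: "disjoint_family_on C {1..k}"
    using assms by (auto simp: coloring_def)
  have "X = (\<Union>i\<in>{1..k}. C i \<inter> X)" using U assms(3) by blast
  moreover have "card (\<Union>i\<in>{1..k}. C i \<inter> X) = (\<Sum>i\<in>{1..k}. card (C i \<inter> X))"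
    using D finite_subset[OF assms(3,2)]
    by (intro card_UN_disjoint) (auto simp: disjoint_family_on_def)
  ultimately show ?thesis by simp
qed

text \<open>Classes that miss \<open>X\<close> contribute zero. The smaller index set lets averaging
  run over only the classes that meet \<open>X\<close>.\<close>

lemma sum_card_meeting_classes:
  assumes "coloring V E k C" "finite V" "X \<subseteq> V"
  shows "(\<Sum>i\<in>{i\<in>{1..k}. C i \<inter> X \<noteq> {}}. card (C i \<inter> X)) = card X"
proof -
  have "(\<Sum>i\<in>{i\<in>{1..k}. C i \<inter> X \<noteq> {}}. card (C i \<inter> X)) = (\<Sum>i\<in>{1..k}. card (C i \<inter> X))"
    by (rule sum.mono_neutral_left) auto
  with sum_card_color_classes[OF assms] show ?thesis by simp
qed

lemma color_class_pigeonhole: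
  assumes "coloring V E k C" "finite V" "X \<subseteq> V"
    and "c * card {i\<in>{1..k}. C i \<inter> X \<noteq> {}} < card X"
  obtains i where "i \<in> {1..k}" "c < card (C i \<inter> X)"
proof -
  let ?Q = "{i\<in>{1..k}. C i \<inter> X \<noteq> {}}"
  have "\<exists>i\<in>?Q. c < card (C i \<inter> X)"
  proof (rule ccontr)
    assume "\<not> ?thesis"
    then have "(\<Sum>i\<in>?Q. card (C i \<inter> X)) \<le> of_nat (card ?Q) * c"
      by (intro sum_bounded_above) auto
    with sum_card_meeting_classes[OF assms(1-3)] assms(4) show False
      by (simp add: mult.commute)
  qed
  then show ?thesis using that by blast
qed

text \<open>An independent class contains at most one vertex of a clique.\<close>

lemma clique_card_le_colors:
  assumes "coloring V E k C" "finite V" "X \<subseteq> V"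
    and clique: "\<And>u v. u \<in> X \<Longrightarrow> v \<in> X \<Longrightarrow> u \<noteq> v \<Longrightarrow> {u, v} \<in> E"
  shows "card X \<le> k"
proof -
  have "card (C i \<inter> X) \<le> 1" if "i \<in> {1..k}" for i
  proof -
    have "independent_set V E (C i)" using assms(1) that by (simp add: coloring_def)
    then have "\<forall>u\<in>C i \<inter> X. \<forall>v\<in>C i \<inter> X. u = v"
      using clique unfolding independent_set_def by blast
    then show ?thesis by (simp add: card_le_Suc0_iff_eq finite_subset[OF assms(3,2)])
  qed
  then have "(\<Sum>i\<in>{1..k}. card (C i \<inter> X)) \<le> of_nat (card {1..k}) * 1"
    by (intro sum_bounded_above) auto
  with sum_card_color_classes[OF assms(1-3)] show ?thesis by simp
qed

text \<open>Whichever vertex EQ1 removes from \<open>C i\<close>, at least \<open>c\<close> vertices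
  of \<open>X\<close> stay behind, each of weight \<open>t\<close>; the other remaining weights are
  nonnegative.\<close>

lemma EQ1_class_weight_lower_bound:
  assumes "EQ1 \<alpha> w k C" "i \<in> {1..k}" "j \<in> {1..k}"
    and "finite (C i)" "\<And>v. v \<in> C i \<Longrightarrow> 0 \<le> w v"
    and "\<And>v. v \<in> X \<Longrightarrow> w v = t" "0 \<le> t" "c < card (C i \<inter> X)"
  shows "real c * t \<le> \<alpha> * sum w (C j)"
proof -
  have "C i \<noteq> {}" using assms(8) by auto
  then obtain v where v: "sum w (C i - {v}) \<le> \<alpha> * sum w (C j)"
    using assms(1-3) unfolding EQ1_def by blast
  have "card (C i \<inter> X) - 1 \<le> card ((C i \<inter> X) - {v})"
    using diff_card_le_card_Diff[of "{v}" "C i \<inter> X"] by simp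
  then have "c \<le> card ((C i \<inter> X) - {v})" using assms(8) by linarith
  then have "real c * t \<le> real (card ((C i \<inter> X) - {v})) * t"
    using assms(7) by (intro mult_right_mono) auto
  also have "\<dots> = sum w ((C i \<inter> X) - {v})" using assms(6) by simp
  also have "\<dots> \<le> sum w (C i - {v})"
    using assms(4,5) by (intro sum_mono2) auto
  finally show ?thesis using v by simp
qed

text \<open>By symmetry every edge at \<open>v\<close> can be written with \<open>v\<close> first,
  so edges at \<open>v\<close> correspond bijectively to neighbors of \<open>v\<close>.\<close>

lemma degree_of_relation:
  assumes "\<And>u v. R u v \<Longrightarrow> R v u"
  shows "degree {{u, v} |u v. R u v} v = card {u. R v u}"
proof -
  have "{e \<in> {{u, v} |u v. R u v}. v \<in> e} = (\<lambda>u. {v, u}) ` {u. R v u}"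
    using assms by (auto simp: insert_commute)
  moreover have "inj_on (\<lambda>u. {v, u}) {u. R v u}"
    by (auto simp: inj_on_def doubleton_eq_iff)
  ultimately show ?thesis by (simp add: degree_def card_image)
qed

text \<open>The sides of the bipartite part are \<open>{..<D}\<close> and \<open>{D..<2*D}\<close>.
  The closed interval \<open>{2*D..3*D}\<close> has \<open>D + 1\<close> elements, so the clique is
  also \<open>D\<close>-regular.\<close>

definition witness_adj :: "nat \<Rightarrow> nat \<Rightarrow> nat \<Rightarrow> bool" where
  "witness_adj D u v \<longleftrightarrow>
     u < D \<and> v \<in> {D..<2*D} \<or> v < D \<and> u \<in> {D..<2*D} \<or>
     u \<in> {2*D..3*D} \<and> v \<in> {2*D..3*D} \<and> u \<noteq> v"

definition witness_edges :: "nat \<Rightarrow> nat set set" where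
  "witness_edges D = {{u, v} |u v. witness_adj D u v}"

definition witness_weight :: "nat \<Rightarrow> nat \<Rightarrow> real" where
  "witness_weight D v = (if v < D then sqrt 2 else if v < 2*D then 1 else 0)"

lemma witness_edgeI: "witness_adj D u v \<Longrightarrow> {u, v} \<in> witness_edges D"
  unfolding witness_edges_def by blast

lemma weighted_graph_witness: "weighted_graph {..3*D} (witness_edges D) (witness_weight D)"
  by (auto simp: weighted_graph_def witness_edges_def witness_adj_def witness_weight_def card_insert_if)

lemma degree_witness:
  assumes "v \<le> 3*D"
  shows "degree (witness_edges D) v = D"
proof -
  have "degree (witness_edges D) v = card {u. witness_adj D v u}"
    unfolding witness_edges_def by (rule degree_of_relation) (auto simp: witness_adj_def)
  also have "{u. witness_adj D v u} =
      (if v < D then {D..<2*D} else if v < 2*D then {..<D} else {2*D..3*D} - {v})"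
    using assms by (auto simp: witness_adj_def)
  also have "card \<dots> = D" using assms by auto
  finally show ?thesis .
qed

lemma max_degree_witness: "max_degree {..3*D} (witness_edges D) = D"
proof -
  have "degree (witness_edges D) ` {..3*D} = {D}"
    using degree_witness by (auto simp: image_iff)
  then show ?thesis by (simp add: max_degree_def)
qed

lemma sum_witness_weight:
  assumes "S \<subseteq> {..3*D}"
  shows "sum (witness_weight D) S = sqrt 2 * card (S \<inter> {..<D}) + card (S \<inter> {D..<2*D})"
proof -
  have fin: "finite S" using assms finite_subset by blast
  \<comment> \<open>Splitting the weight into two indicator terms turns each sum into a
    cardinality.\<close>
  have "sum (witness_weight D) S =
      (\<Sum>v\<in>S. (if v \<in> {..<D} then sqrt 2 else 0) + (if v \<in> {D..<2*D} then 1 else 0))"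
    by (rule sum.cong) (auto simp: witness_weight_def)
  also have "\<dots> = sqrt 2 * card (S \<inter> {..<D}) + card (S \<inter> {D..<2*D})"
    unfolding sum.distrib sum.inter_restrict[OF fin, symmetric] by simp
  finally show ?thesis .
qed

lemma no_EQ1_coloring_witness:
  assumes k: "2 * k < 6*m + 3" and \<alpha>: "1 \<le> \<alpha>" "\<alpha> < sqrt 2" and D: "D = 2*m + 1"
    and col: "coloring {..3*D} (witness_edges D) k C" and eq: "EQ1 \<alpha> (witness_weight D) k C"
  shows False
proof -
  define A B where "A = {..<D}" and "B = {D..<2*D}"
  define P Q where "P = {i\<in>{1..k}. C i \<inter> A \<noteq> {}}" and "Q = {i\<in>{1..k}. C i \<inter> B \<noteq> {}}"
  have fin: "finite {..3*D}" by simp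
  have AV: "A \<subseteq> {..3*D}" and BV: "B \<subseteq> {..3*D}" by (auto simp: A_def B_def)
  have CV: "C i \<subseteq> {..3*D}" if "i \<in> {1..k}" for i
    using col that unfolding coloring_def independent_set_def by blast
  have finC: "finite (C i)" if "i \<in> {1..k}" for i using CV[OF that] finite_subset by blast
  have wC: "sum (witness_weight D) (C i) = sqrt 2 * card (C i \<inter> A) + card (C i \<inter> B)"
    if "i \<in> {1..k}" for i using sum_witness_weight[OF CV[OF that]] by (simp add: A_def B_def)
  have cA: "card A = D" and cB: "card B = D" by (auto simp: A_def B_def)
  have finP: "finite P" and finQ: "finite Q" by (auto simp: P_def Q_def)
  have "P \<inter> Q = {}"
  proof -
    have False if "i \<in> {1..k}" "u \<in> C i" "u \<in> A" "v \<in> C i" "v \<in> B" for i u v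
    proof -
      have "{u, v} \<in> witness_edges D" using that
        by (intro witness_edgeI) (auto simp: witness_adj_def A_def B_def)
      with col that show False unfolding coloring_def independent_set_def by blast
    qed
    then show ?thesis unfolding P_def Q_def by blast
  qed
  then have "card P + card Q = card (P \<union> Q)" using finP finQ by (simp add: card_Un_disjoint)
  also have "\<dots> \<le> card {1..k}" by (intro card_mono) (auto simp: P_def Q_def)
  finally have PQ: "card P + card Q \<le> k" by simp
  have "card {2*D..3*D} \<le> k"
    by (rule clique_card_le_colors[OF col fin]) (auto intro!: witness_edgeI simp: witness_adj_def)
  then have kD: "D + 1 \<le> k" by simp
  have \<alpha>0: "0 < \<alpha>" using \<alpha> by simp
  show False
  proof (cases "card Q \<le> m")
    case True
    then have "2 * card {i\<in>{1..k}. C i \<inter> B \<noteq> {}} < card B"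
      using cB D by (simp add: Q_def)
    then obtain i where i: "i \<in> {1..k}" "2 < card (C i \<inter> B)"
      using color_class_pigeonhole[OF col fin BV] by blast
    have "2 \<le> card (C j \<inter> A) + card (C j \<inter> B)" if j: "j \<in> {1..k}" for j
    proof (rule ccontr)
      assume "\<not> ?thesis"
      \<comment> \<open>At most one vertex of positive weight is left, and the heaviest one weighs
        \<open>sqrt 2\<close>.\<close>
      then have "(card (C j \<inter> A) = 0 \<or> card (C j \<inter> A) = 1 \<and> card (C j \<inter> B) = 0) \<and>
          card (C j \<inter> B) \<le> 1" by linarith
      then have "sum (witness_weight D) (C j) \<le> sqrt 2"
        unfolding wC[OF j] using real_sqrt_ge_1_iff[of 2] by (auto intro: order_trans[of _ 1])
      then have "\<alpha> * sum (witness_weight D) (C j) \<le> \<alpha> * sqrt 2"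
        using \<alpha>0 by (intro mult_left_mono) auto
      also have "\<dots> < sqrt 2 * sqrt 2" using \<alpha> by (intro mult_strict_right_mono) auto
      also have "\<dots> = 2" by simp
      finally have "\<alpha> * sum (witness_weight D) (C j) < 2" .
      moreover have "real 2 * 1 \<le> \<alpha> * sum (witness_weight D) (C j)"
        by (rule EQ1_class_weight_lower_bound[where X = B, OF eq i(1) j finC[OF i(1)]])
          (use i in \<open>auto simp: witness_weight_def B_def\<close>)
      ultimately show False by simp
    qed
    \<comment> \<open>Counting \<open>A\<close> and \<open>B\<close> together gives
      \<open>k \<le> D\<close>, against the clique bound \<open>kD\<close>.\<close>
    then have "of_nat (card {1..k}) * 2 \<le> (\<Sum>j\<in>{1..k}. card (C j \<inter> A) + card (C j \<inter> B))"
      by (intro sum_bounded_below) auto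
    also have "\<dots> = 2 * D"
      using sum_card_color_classes[OF col fin AV] sum_card_color_classes[OF col fin BV] cA cB
      by (simp add: sum.distrib)
    finally show False using kD by simp
  next
    case False
    \<comment> \<open>Since \<open>k \<le> 3*m + 1\<close> and \<open>card Q \<ge> m + 1\<close>, at
      most \<open>2*m\<close> classes meet \<open>A\<close>.\<close>
    then have "1 * card {i\<in>{1..k}. C i \<inter> A \<noteq> {}} < card A"
      using cA D k PQ by (simp add: P_def)
    then obtain i where i: "i \<in> {1..k}" "1 < card (C i \<inter> A)"
      using color_class_pigeonhole[OF col fin AV] by blast
    have "2 \<le> card (C j \<inter> B)" if jQ: "j \<in> Q" for j
    proof (rule ccontr)
      assume "\<not> ?thesis"
      \<comment> \<open>A class in \<open>Q\<close> draws all its weight from \<open>B\<close>, so a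
        single vertex there gives weight only 1.\<close>
      have j: "j \<in> {1..k}" and "C j \<inter> A = {}"
        using jQ \<open>P \<inter> Q = {}\<close> by (auto simp: P_def Q_def)
      then have "sum (witness_weight D) (C j) \<le> 1"
        unfolding wC[OF j] using \<open>\<not> 2 \<le> card (C j \<inter> B)\<close> by simp
      then have "\<alpha> * sum (witness_weight D) (C j) \<le> \<alpha> * 1"
        using \<alpha>0 by (intro mult_left_mono) auto
      moreover have "real 1 * sqrt 2 \<le> \<alpha> * sum (witness_weight D) (C j)"
        by (rule EQ1_class_weight_lower_bound[where X = A, OF eq i(1) j finC[OF i(1)]])
          (use i in \<open>auto simp: witness_weight_def A_def\<close>)
      ultimately show False using \<alpha> by linarith
    qed
    then have "of_nat (card Q) * 2 \<le> (\<Sum>j\<in>Q. card (C j \<inter> B))"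
      by (intro sum_bounded_below) auto
    also have "\<dots> = D"
      using sum_card_meeting_classes[OF col fin BV] cB by (simp add: Q_def)
    finally show False using False D by simp
  qed
qed

theorem theorem2:
  fixes \<Delta> :: nat
  assumes "odd \<Delta>" and "3 \<le> \<Delta>"
  shows "\<exists>(V :: nat set) E w.
           weighted_graph V E w \<and> max_degree V E = \<Delta> \<and>
           (\<forall>(k :: nat) (\<alpha> :: real).
              real k < 3 * real \<Delta> / 2 \<longrightarrow> 1 \<le> \<alpha> \<longrightarrow> \<alpha> < sqrt 2 \<longrightarrow>
              \<not> (\<exists>C. coloring V E k C \<and> EQ1 \<alpha> w k C))"
proof -
  obtain m where m: "\<Delta> = 2*m + 1" using assms(1) by (elim oddE)
  \<comment> \<open>Doubling clears the fraction, so the bound on \<open>k\<close> can be used in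
    the naturals.\<close>
  have "2 * k < 6*m + 3" if "real k < 3 * real \<Delta> / 2" for k
    using that m by simp
  then show ?thesis
    using weighted_graph_witness[of \<Delta>] max_degree_witness[of \<Delta>] no_EQ1_coloring_witness[OF _ _ _ m]
    by blast
qed

end
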